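(* Let $X$ be a real-valued random variable with distribution $F$. Let $A=[-X\mid X<0]$ and $B=[X\mid X\geq 0]$ be the associated nonnegative random variables. If the mixed Poisson distribution $Poi\bigwedge F$ exists, then all of the following hold: 1. Either $\Pr(X<0)=0$ or $\Pr(X>0)>0$. 2. If $\Pr(X<0)>0$, then $A$ is subexponential with $\mathbb{E}[e^{A}]<\infty$. 3. For every $q>0$: if $\Pr(X<0)>0$ and $B$ is $q$-subweibull, then $A$ is also $q$-subweibull.
   Context: Notation: $\mathbb{N}_0=\{0,1,2,\dots\}$. $A=[-X\mid X<0]$ denotes a random variable whose law is the conditional law of $-X$ given $X<0$ (when $\Pr(X<0)>0$), and $B=[X\mid X\ge 0]$ a random variable whose law is the conditional law of $X$ given $X\geq 0$ (when $\Pr(X\geq 0)>0$). A function $f$ on $\mathbb{N}_0$ is a valid probability mass function (PMF) if $f(n)\geq 0$ for all $n\in\mathbb{N}_0$ and $\sum_{n=0}^\infty f(n)=1$. For a real-valued random variable $X\sim F$ (not assumed nonnegative), the mixed Poisson distribution generated by $F$, denoted $Poi\bigwedge F$, is the distribution on $\mathbb{N}_0$ with PMF $f(n)=\mathbb{E}\left[X^n e^{-X}\right]/n!$, provided this $f$ is a valid PMF (in particular each expectation must be well defined and finite). The mixed Poisson distribution $Poi\bigwedge F$ is said to exist if this $f$ is a valid PMF. For $q>0$, a random variable $Z$ is $q$-subweibull if $\mathbb{E}[\exp(\lambda^q|Z|^q)]<\infty$ for some $\lambda>0$. "Subexponential" means $1$-subweibull. *)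

theory Defs
  imports "HOL-Probability.Probability"
begin

definition valid_pmf :: "(nat \<Rightarrow> real) \<Rightarrow> bool" where
  "valid_pmf f \<longleftrightarrow> (\<forall>n. 0 \<le> f n) \<and> f sums 1"

definition mixed_poisson_weight :: "real measure \<Rightarrow> nat \<Rightarrow> real" where
  "mixed_poisson_weight F n = (\<integral>x. x ^ n * exp (- x) \<partial>F) / fact n"

text \<open>
  Integrability is required explicitly, since the Bochner integral of a
  non-integrable function is \<open>0\<close>.
\<close>
definition mixed_poisson_exists :: "real measure \<Rightarrow> bool" where
  "mixed_poisson_exists F \<longleftrightarrow>
     (\<forall>n::nat. integrable F (\<lambda>x. x ^ n * exp (- x))) \<and> valid_pmf (mixed_poisson_weight F)"

text \<open>
  \<open>has_cond_law N A M Z S\<close>: the random variable \<open>A\<close>, defined on the possibly different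
  probability space \<open>N\<close>, has the conditional law of \<open>Z\<close> given the event \<open>S\<close> of \<open>M\<close>.
  It is meant for events \<open>S\<close> of positive probability.
\<close>
definition has_cond_law ::
  "'b measure \<Rightarrow> ('b \<Rightarrow> real) \<Rightarrow> 'a measure \<Rightarrow> ('a \<Rightarrow> real) \<Rightarrow> 'a set \<Rightarrow> bool" where
  "has_cond_law N A M Z S \<longleftrightarrow>
     prob_space N \<and> A \<in> borel_measurable N \<and>
     distr N borel A = distr (uniform_measure M S) borel Z"

text \<open>
  The integrand is nonnegative, so for a measurable \<open>Z\<close> integrability says exactly that the
  expectation is finite.
\<close>
definition subweibull :: "real \<Rightarrow> 'a measure \<Rightarrow> ('a \<Rightarrow> real) \<Rightarrow> bool" where
  "subweibull q M Z \<longleftrightarrow>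
     (\<exists>c>0. integrable M (\<lambda>\<omega>. exp (c powr q * \<bar>Z \<omega>\<bar> powr q)))"

abbreviation subexponential :: "'a measure \<Rightarrow> ('a \<Rightarrow> real) \<Rightarrow> bool" where
  "subexponential \<equiv> subweibull 1"

end

theory Submission
  imports Defs
begin

text \<open>
  For odd \<open>m\<close>, nonnegativity of the weight at \<open>m\<close> says that the part of \<open>X ^ m * exp (- X)\<close>
  on \<open>X < 0\<close> is dominated in mean by the part on \<open>X \<ge> 0\<close>. Given \<open>k\<close>, take \<open>m\<close> odd with
  \<open>q k \<le> m \<le> q k + 2\<close>: the factor \<open>exp (- X)\<close> is at least \<open>1\<close> on the negative side, and on the
  positive side it absorbs the excess \<open>X ^ 2\<close>. This compares the moments of order \<open>q k\<close> on both
  sides with constants independent of \<open>k\<close>; summing the exponential series carries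
  the \<open>q\<close>-subweibull bound from \<open>B\<close> to \<open>A\<close>, with the same scale.
\<close>

section \<open>Integration tools and transfer to conditional laws\<close>

lemma nn_integral_neg_part_le_pos_part:
  fixes f :: "'a \<Rightarrow> real"
  assumes "integrable M f" and "0 \<le> integral\<^sup>L M f"
  shows "(\<integral>\<^sup>+x. ennreal (- f x) \<partial>M) \<le> (\<integral>\<^sup>+x. ennreal (f x) \<partial>M)"
proof -
  have fin: "(\<integral>\<^sup>+x. ennreal (f x) \<partial>M) \<noteq> \<infinity>" "(\<integral>\<^sup>+x. ennreal (- f x) \<partial>M) \<noteq> \<infinity>"
    using assms(1) by (simp_all add: real_integrable_def)
  \<comment> \<open>The integral is the difference of these two finite values. The result goes back
    to \<open>ennreal\<close>, where the later bounds may be infinite and sums and integrals commute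
    freely.\<close>
  have "enn2real (\<integral>\<^sup>+x. ennreal (- f x) \<partial>M) \<le> enn2real (\<integral>\<^sup>+x. ennreal (f x) \<partial>M)"
    using assms by (simp add: real_lebesgue_integral_def)
  then have "ennreal (enn2real (\<integral>\<^sup>+x. ennreal (- f x) \<partial>M))
      \<le> ennreal (enn2real (\<integral>\<^sup>+x. ennreal (f x) \<partial>M))"
    by (rule ennreal_leI)
  then show ?thesis
    using fin by (simp only: ennreal_enn2real_if) simp
qed

text \<open>Equal laws give equal integrability, and conditioning only divides by the positive
  number \<open>emeasure M S\<close>, which does not affect finiteness. All statements about
  \<open>A\<close> and \<open>B\<close> thus become statements about \<open>X\<close> on two
  disjoint events of \<open>M\<close>.\<close>

lemma integrable_has_cond_law_iff:
  fixes h :: "real \<Rightarrow> real"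
  assumes law: "has_cond_law N A M Z S"
    and M: "prob_space M" and S: "S \<in> sets M" "measure M S > 0"
    and Z: "Z \<in> borel_measurable M"
    and h: "h \<in> borel_measurable borel" "\<And>x. 0 \<le> h x"
  shows "integrable N (\<lambda>\<omega>. h (A \<omega>)) \<longleftrightarrow>
    (\<integral>\<^sup>+\<omega>. ennreal (h (Z \<omega>)) * indicator S \<omega> \<partial>M) < \<infinity>"
proof -
  interpret prob_space M by fact
  have A: "A \<in> borel_measurable N" and eq: "distr N borel A = distr (uniform_measure M S) borel Z"
    using law by (auto simp: has_cond_law_def)
  have ZU: "Z \<in> borel_measurable (uniform_measure M S)"
    using Z by simp
  have "integrable N (\<lambda>\<omega>. h (A \<omega>)) \<longleftrightarrow> integrable (uniform_measure M S) (\<lambda>\<omega>. h (Z \<omega>))"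
    using integrable_distr_eq[OF A h(1)] integrable_distr_eq[OF ZU h(1)] eq by simp
  also have "\<dots> \<longleftrightarrow> (\<integral>\<^sup>+\<omega>. ennreal (h (Z \<omega>)) \<partial>uniform_measure M S) < \<infinity>"
    using Z h by (simp add: integrable_iff_bounded)
  also have "(\<integral>\<^sup>+\<omega>. ennreal (h (Z \<omega>)) \<partial>uniform_measure M S)
      = (\<integral>\<^sup>+\<omega>. ennreal (h (Z \<omega>)) * indicator S \<omega> \<partial>M) / emeasure M S"
    using Z h S by (intro nn_integral_uniform_measure) auto
  also have "\<dots> < \<infinity> \<longleftrightarrow> (\<integral>\<^sup>+\<omega>. ennreal (h (Z \<omega>)) * indicator S \<omega> \<partial>M) < \<infinity>"
    using S by (auto simp: less_top[symmetric] ennreal_divide_eq_top_iff emeasure_eq_measure)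
  finally show ?thesis .
qed

section \<open>Elementary inequalities\<close>

lemma exists_odd_between:
  fixes t :: real
  assumes "0 \<le> t"
  obtains m :: nat where "odd m" "t \<le> real m" "real m \<le> t + 2"
proof -
  define n where "n = nat \<lceil>t\<rceil>"
  have n: "t \<le> real n" "real n \<le> t + 1"
    using assms unfolding n_def by linarith+
  \<comment> \<open>Either the ceiling of \<open>t\<close> or its successor is odd; the successor
    costs the slack 2.\<close>
  show thesis
    using that[of n] that[of "Suc n"] n by (cases "odd n") auto
qed

text \<open>The summand 1 covers the case of absolute value at most 1; beyond that the larger
  exponent \<open>m\<close> wins. The factor \<open>exp (- x)\<close> is at least 1 because
  \<open>x\<close> is negative.\<close>

lemma abs_powr_power_le:
  fixes x q :: real
  assumes "x < 0" "0 < q" "odd m" "q * real k \<le> real m"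
  shows "(\<bar>x\<bar> powr q) ^ k \<le> 1 + - (x ^ m * exp (- x))"
proof -
  have m: "- (x ^ m * exp (- x)) = \<bar>x\<bar> ^ m * exp (- x)"
    using assms by (simp add: power_minus_odd)
  have "(\<bar>x\<bar> powr q) ^ k \<le> 1 + \<bar>x\<bar> ^ m"
  proof (cases "\<bar>x\<bar> \<le> 1")
    case True
    then show ?thesis
      using assms(2) by (intro add_increasing2 power_le_one powr_le1) auto
  next
    case False
    then have "(\<bar>x\<bar> powr q) ^ k = \<bar>x\<bar> powr (q * real k)"
      by (simp add: powr_power mult.commute)
    also have "\<dots> \<le> \<bar>x\<bar> powr real m"
      using False assms(4) by (intro powr_mono) auto
    also have "\<dots> = \<bar>x\<bar> ^ m"
      using assms(1) by (simp add: powr_realpow)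
    finally show ?thesis by simp
  qed
  also have "\<bar>x\<bar> ^ m \<le> \<bar>x\<bar> ^ m * exp (- x)"
    using assms(1) by (simp add: mult_le_cancel_left1)
  finally show ?thesis
    using m by simp
qed

text \<open>For \<open>x\<close> above 1 the excess in the exponent is at most 2, and
  \<open>exp x\<close> is at least \<open>x\<^sup>2 / 2\<close> by its quadratic Taylor bound,
  whence the factor 2. The summand 1 covers \<open>x\<close> up to 1.\<close>

lemma power_exp_minus_le:
  fixes x q :: real
  assumes "0 \<le> x" "real m \<le> q * real k + 2"
  shows "x ^ m * exp (- x) \<le> 1 + 2 * (\<bar>x\<bar> powr q) ^ k"
proof (cases "x \<le> 1")
  case True
  have "x ^ m * exp (- x) \<le> 1 * 1"
    using assms(1) True by (intro mult_mono power_le_one) auto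
  then show ?thesis
    by (simp add: add_increasing2)
next
  case False
  then have x: "1 < x" by simp
  have "x ^ m = x powr real m"
    using x by (simp add: powr_realpow)
  also have "\<dots> \<le> x powr (q * real k + 2)"
    using x assms(2) by (intro powr_mono) auto
  also have "\<dots> = (x powr q) ^ k * x\<^sup>2"
    using x by (simp add: powr_add powr_power mult.commute)
  finally have "x ^ m * exp (- x) \<le> (x powr q) ^ k * (x\<^sup>2 * exp (- x))"
    by (simp add: mult.assoc[symmetric])
  also have "x\<^sup>2 * exp (- x) \<le> 2"
    using exp_lower_Taylor_quadratic[of x] x by (simp add: exp_minus field_simps)
  finally show ?thesis
    using x by (simp add: mult.commute)
qed

lemma ennreal_exp_eq_suminf:
  fixes y :: real
  assumes "0 \<le> y"
  shows "ennreal (exp y) = (\<Sum>k. ennreal (y ^ k / fact k))"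
proof -
  have "(\<lambda>k. y ^ k / fact k) sums exp y"
    using exp_converges[of y] by (simp add: divide_inverse mult.commute scaleR_conv_of_real)
  then show ?thesis
    using assms by (subst suminf_ennreal_eq[where x = "exp y"]) auto
qed

section \<open>Consequences of existence of the mixed Poisson law\<close>

context
  fixes M :: "'a measure" and X :: "'a \<Rightarrow> real"
  assumes M: "prob_space M" and X[measurable]: "X \<in> borel_measurable M"
    and ex: "mixed_poisson_exists (distr M borel X)"
begin

lemma mixed_poisson_integrable: "integrable M (\<lambda>\<omega>. X \<omega> ^ n * exp (- X \<omega>))"
  using ex by (auto simp: mixed_poisson_exists_def integrable_distr_eq)

lemma mixed_poisson_expectation_nonneg: "0 \<le> (\<integral>\<omega>. X \<omega> ^ n * exp (- X \<omega>) \<partial>M)"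
proof -
  have "0 \<le> mixed_poisson_weight (distr M borel X) n * fact n"
    using ex by (simp add: mixed_poisson_exists_def valid_pmf_def)
  then show ?thesis
    by (simp add: mixed_poisson_weight_def integral_distr)
qed

text \<open>Uses the weight at 1: if \<open>X\<close> were almost surely nonpositive, then
  \<open>X * exp (- X)\<close> would have zero positive part, hence by nonnegativity of its mean
  also zero negative part, so \<open>X\<close> could not be negative with positive
  probability.\<close>

lemma mixed_poisson_pos_of_neg:
  assumes "measure M {\<omega> \<in> space M. X \<omega> < 0} > 0"
  shows "measure M {\<omega> \<in> space M. X \<omega> > 0} > 0"
proof (rule ccontr)
  interpret prob_space M by (rule M)
  assume "\<not> ?thesis"
  then have "measure M {\<omega> \<in> space M. X \<omega> > 0} = 0"
    by (simp add: zero_less_measure_iff)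
  then have nonpos: "AE \<omega> in M. X \<omega> \<le> 0"
    by (subst (asm) prob_eq_0) (auto simp: not_less)
  then have "(\<integral>\<^sup>+\<omega>. ennreal (X \<omega> ^ 1 * exp (- X \<omega>)) \<partial>M) = 0"
    by (subst nn_integral_0_iff_AE) (auto simp: ennreal_eq_0_iff mult_le_0_iff)
  then have "(\<integral>\<^sup>+\<omega>. ennreal (- (X \<omega> ^ 1 * exp (- X \<omega>))) \<partial>M) = 0"
    using nn_integral_neg_part_le_pos_part[OF mixed_poisson_integrable
        mixed_poisson_expectation_nonneg, of 1] by simp
  then have "AE \<omega> in M. \<not> X \<omega> < 0"
    by (subst (asm) nn_integral_0_iff_AE) (auto simp: ennreal_eq_0_iff zero_le_mult_iff not_less)
  then have "measure M {\<omega> \<in> space M. X \<omega> < 0} = 0"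
    by (subst prob_eq_0) auto
  with assms show False by simp
qed

text \<open>This is integrability for the weight at 0, restricted to the negative event.\<close>

lemma mixed_poisson_exp_neg_finite:
  "(\<integral>\<^sup>+\<omega>. ennreal (exp (- X \<omega>)) * indicator {\<omega> \<in> space M. X \<omega> < 0} \<omega> \<partial>M) < \<infinity>"
proof -
  have "(\<integral>\<^sup>+\<omega>. ennreal (exp (- X \<omega>)) * indicator {\<omega> \<in> space M. X \<omega> < 0} \<omega> \<partial>M)
      \<le> (\<integral>\<^sup>+\<omega>. ennreal (exp (- X \<omega>)) \<partial>M)"
    by (intro nn_integral_mono) (simp add: indicator_def)
  also have "\<dots> < \<infinity>"
    using mixed_poisson_integrable[of 0] by (simp add: integrable_iff_bounded)
  finally show ?thesis .
qed

lemma mixed_poisson_moment_le: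
  assumes q: "0 < q"
  shows "(\<integral>\<^sup>+\<omega>. ennreal ((\<bar>X \<omega>\<bar> powr q) ^ k) * indicator {\<omega> \<in> space M. X \<omega> < 0} \<omega> \<partial>M)
    \<le> 2 + 2 * (\<integral>\<^sup>+\<omega>. ennreal ((\<bar>X \<omega>\<bar> powr q) ^ k) * indicator {\<omega> \<in> space M. X \<omega> \<ge> 0} \<omega> \<partial>M)"
    (is "?L \<le> 2 + 2 * ?R")
proof -
  interpret prob_space M by (rule M)
  obtain m where m: "odd m" "q * real k \<le> real m" "real m \<le> q * real k + 2"
    using exists_odd_between[of "q * real k"] q by auto
  have "?L \<le> (\<integral>\<^sup>+\<omega>. 1 + ennreal (- (X \<omega> ^ m * exp (- X \<omega>))) \<partial>M)"
  proof (rule nn_integral_mono)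
    fix \<omega> assume "\<omega> \<in> space M"
    show "ennreal ((\<bar>X \<omega>\<bar> powr q) ^ k) * indicator {\<omega> \<in> space M. X \<omega> < 0} \<omega>
        \<le> 1 + ennreal (- (X \<omega> ^ m * exp (- X \<omega>)))"
    proof (cases "X \<omega> < 0")
      case True
      \<comment> \<open>Nonnegativity is needed to split \<open>ennreal\<close> over the sum in the
        pointwise bound, since \<open>ennreal\<close> truncates negative numbers to 0.\<close>
      have "0 \<le> - (X \<omega> ^ m * exp (- X \<omega>))"
        using True m(1) by (simp add: mult_le_0_iff power_le_zero_eq odd_pos)
      then show ?thesis
        using ennreal_leI[OF abs_powr_power_le[OF True q m(1,2)]]
        by (simp only: ennreal_plus zero_le_one ennreal_1) (auto simp: indicator_def)
    qed simp
  qed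
  also have "\<dots> = 1 + (\<integral>\<^sup>+\<omega>. ennreal (- (X \<omega> ^ m * exp (- X \<omega>))) \<partial>M)"
    by (subst nn_integral_add) (auto simp: emeasure_space_1)
  \<comment> \<open>Nonnegativity of the weight at \<open>m\<close> crosses from the negative to the
    positive side. Each pointwise bound contributes a 1 of total mass 1, which gives the constant
    2.\<close>
  also have "\<dots> \<le> 1 + (\<integral>\<^sup>+\<omega>. ennreal (X \<omega> ^ m * exp (- X \<omega>)) \<partial>M)"
    by (intro add_left_mono nn_integral_neg_part_le_pos_part
        mixed_poisson_integrable mixed_poisson_expectation_nonneg)
  also have "(\<integral>\<^sup>+\<omega>. ennreal (X \<omega> ^ m * exp (- X \<omega>)) \<partial>M) \<le> (\<integral>\<^sup>+\<omega>. 1 +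
      2 * (ennreal ((\<bar>X \<omega>\<bar> powr q) ^ k) * indicator {\<omega> \<in> space M. X \<omega> \<ge> 0} \<omega>) \<partial>M)"
  proof (rule nn_integral_mono)
    fix \<omega> assume w: "\<omega> \<in> space M"
    show "ennreal (X \<omega> ^ m * exp (- X \<omega>)) \<le> 1 +
      2 * (ennreal ((\<bar>X \<omega>\<bar> powr q) ^ k) * indicator {\<omega> \<in> space M. X \<omega> \<ge> 0} \<omega>)"
    proof (cases "0 \<le> X \<omega>")
      case True
      show ?thesis
        using ennreal_leI[OF power_exp_minus_le[OF True m(3)]] True w
        by (simp add: ennreal_plus ennreal_mult)
    next
      case False
      then have "X \<omega> ^ m * exp (- X \<omega>) \<le> 0"
        using m(1) by (simp add: mult_le_0_iff power_le_zero_eq odd_pos)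
      then show ?thesis by (simp add: ennreal_neg)
    qed
  qed
  also have "\<dots> = 1 + 2 * ?R"
    by (subst nn_integral_add) (auto simp: emeasure_space_1 nn_integral_cmult)
  finally show ?thesis
    by (simp add: add.assoc[symmetric] add_left_mono)
qed

lemma mixed_poisson_exp_moment_le:
  assumes q: "0 < q" and s: "0 \<le> s"
  shows "(\<integral>\<^sup>+\<omega>. ennreal (exp (s * \<bar>X \<omega>\<bar> powr q)) * indicator {\<omega> \<in> space M. X \<omega> < 0} \<omega> \<partial>M)
    \<le> 2 * ennreal (exp s) + 2 *
      (\<integral>\<^sup>+\<omega>. ennreal (exp (s * \<bar>X \<omega>\<bar> powr q)) * indicator {\<omega> \<in> space M. X \<omega> \<ge> 0} \<omega> \<partial>M)"
proof -
  define c where "c k = ennreal (s ^ k / fact k)" for k :: nat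
  define I where "I k S = (\<integral>\<^sup>+\<omega>. ennreal ((\<bar>X \<omega>\<bar> powr q) ^ k) * indicator S \<omega> \<partial>M)" for k S
  \<comment> \<open>All terms are nonnegative, so the exponential series may be integrated term by
    term with no convergence condition.\<close>
  have series: "(\<integral>\<^sup>+\<omega>. ennreal (exp (s * \<bar>X \<omega>\<bar> powr q)) * indicator S \<omega> \<partial>M) = (\<Sum>k. c k * I k S)"
    if S[measurable]: "S \<in> sets M" for S
  proof -
    have "ennreal (exp (s * \<bar>X \<omega>\<bar> powr q)) * indicator S \<omega>
        = (\<Sum>k. c k * (ennreal ((\<bar>X \<omega>\<bar> powr q) ^ k) * indicator S \<omega>))" for \<omega>
      using s by (simp add: ennreal_exp_eq_suminf c_def mult.assoc[symmetric] ennreal_suminf_multc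
          ennreal_mult[symmetric] power_mult_distrib)
    then show ?thesis
      by (simp add: nn_integral_suminf nn_integral_cmult I_def)
  qed
  \<comment> \<open>The constants of the moment bound do not depend on \<open>k\<close>, so
    weighting by \<open>c k\<close> and summing turns the additive 2 into \<open>2 * exp s\<close>
    and keeps the same \<open>s\<close> on both sides.\<close>
  have "(\<Sum>k. c k * I k {\<omega> \<in> space M. X \<omega> < 0})
      \<le> (\<Sum>k. c k * (2 + 2 * I k {\<omega> \<in> space M. X \<omega> \<ge> 0}))"
    unfolding I_def by (intro suminf_le mult_left_mono mixed_poisson_moment_le q) auto
  also have "\<dots> = (\<Sum>k. 2 * c k + 2 * (c k * I k {\<omega> \<in> space M. X \<omega> \<ge> 0}))"
    by (simp add: distrib_left mult_ac)
  also have "\<dots> = 2 * (\<Sum>k. c k) + 2 * (\<Sum>k. c k * I k {\<omega> \<in> space M. X \<omega> \<ge> 0})"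
    by (subst suminf_add[symmetric]) (auto simp: ennreal_suminf_cmult)
  also have "(\<Sum>k. c k) = ennreal (exp s)"
    using s by (simp add: c_def ennreal_exp_eq_suminf)
  finally show ?thesis
    by (subst (1 2) series) auto
qed

end

section \<open>Assembly of the three claims\<close>

theorem theorem3p2:
  fixes M :: "'a measure" and X :: "'a \<Rightarrow> real" and F :: "real measure"
    and N\<^sub>A :: "'b measure" and A :: "'b \<Rightarrow> real"
    and N\<^sub>B :: "'c measure" and B :: "'c \<Rightarrow> real"
  assumes "prob_space M"
    and "X \<in> borel_measurable M"
    and "F = distr M borel X"
    and "measure M {\<omega> \<in> space M. X \<omega> < 0} > 0 \<Longrightarrow>
           has_cond_law N\<^sub>A A M (\<lambda>\<omega>. - X \<omega>) {\<omega> \<in> space M. X \<omega> < 0}"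
    and "measure M {\<omega> \<in> space M. X \<omega> \<ge> 0} > 0 \<Longrightarrow>
           has_cond_law N\<^sub>B B M X {\<omega> \<in> space M. X \<omega> \<ge> 0}"
    and "mixed_poisson_exists F"
  shows "(measure M {\<omega> \<in> space M. X \<omega> < 0} = 0 \<or> measure M {\<omega> \<in> space M. X \<omega> > 0} > 0) \<and>
    (measure M {\<omega> \<in> space M. X \<omega> < 0} > 0 \<longrightarrow>
       subexponential N\<^sub>A A \<and> integrable N\<^sub>A (\<lambda>\<omega>. exp (A \<omega>))) \<and>
    (\<forall>q>0. measure M {\<omega> \<in> space M. X \<omega> < 0} > 0 \<and> subweibull q N\<^sub>B B \<longrightarrow>
       subweibull q N\<^sub>A A)"
proof (intro conjI impI allI)
  let ?Neg = "{\<omega> \<in> space M. X \<omega> < 0}" and ?Pos = "{\<omega> \<in> space M. X \<omega> \<ge> 0}"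
  interpret prob_space M by fact
  note X[measurable] = assms(2)
  have ex: "mixed_poisson_exists (distr M borel X)"
    using assms(3,6) by simp
  note pos = mixed_poisson_pos_of_neg[OF assms(1,2) ex]
  have transfer_A: "integrable N\<^sub>A (\<lambda>\<omega>. h (A \<omega>)) \<longleftrightarrow>
      (\<integral>\<^sup>+\<omega>. ennreal (h (- X \<omega>)) * indicator ?Neg \<omega> \<partial>M) < \<infinity>"
    if "prob ?Neg > 0" "h \<in> borel_measurable borel" "\<And>x. 0 \<le> h x" for h :: "real \<Rightarrow> real"
    using that by (intro integrable_has_cond_law_iff[OF assms(4,1)]) auto
  show "prob ?Neg = 0 \<or> prob {\<omega> \<in> space M. X \<omega> > 0} > 0"
    using pos by (auto simp: zero_less_measure_iff)
  show "integrable N\<^sub>A (\<lambda>\<omega>. exp (A \<omega>))" if "prob ?Neg > 0"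
    using mixed_poisson_exp_neg_finite[OF assms(1,2) ex] transfer_A[OF that, of exp] by simp
  show "subexponential N\<^sub>A A" if neg: "prob ?Neg > 0"
  proof -
    \<comment> \<open>On \<open>?Neg\<close> the absolute value of \<open>- X\<close> is
      \<open>- X\<close> itself, so finiteness of the exponential moment gives scale 1.\<close>
    have "(\<integral>\<^sup>+\<omega>. ennreal (exp \<bar>- X \<omega>\<bar>) * indicator ?Neg \<omega> \<partial>M) < \<infinity>"
      using mixed_poisson_exp_neg_finite[OF assms(1,2) ex]
      by (rule back_subst[where P = "\<lambda>x. x < \<infinity>"])
        (auto intro!: nn_integral_cong simp: indicator_def)
    then have "integrable N\<^sub>A (\<lambda>\<omega>. exp \<bar>A \<omega>\<bar>)"
      using transfer_A[OF neg, of "\<lambda>x. exp \<bar>x\<bar>"] by simp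
    then show ?thesis
      by (auto simp: subweibull_def intro!: exI[of _ 1])
  qed
  fix q :: real
  assume q: "0 < q" and *: "prob ?Neg > 0 \<and> subweibull q N\<^sub>B B"
  then have neg: "prob ?Neg > 0" by simp
  from * obtain c where c: "c > 0" "integrable N\<^sub>B (\<lambda>\<omega>. exp (c powr q * \<bar>B \<omega>\<bar> powr q))"
    by (auto simp: subweibull_def)
  \<comment> \<open>The first claim makes \<open>?Pos\<close> an event of positive probability, so
    that \<open>B\<close> really has the conditional law.\<close>
  have "prob {\<omega> \<in> space M. X \<omega> > 0} \<le> prob ?Pos"
    by (intro finite_measure_mono) auto
  with pos[OF neg] have "prob ?Pos > 0" by simp
  then have "(\<integral>\<^sup>+\<omega>. ennreal (exp (c powr q * \<bar>X \<omega>\<bar> powr q)) * indicator ?Pos \<omega> \<partial>M) < \<infinity>"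
    using c(2) integrable_has_cond_law_iff[OF assms(5,1), of "\<lambda>x. exp (c powr q * \<bar>x\<bar> powr q)"]
    by simp
  then have "2 * ennreal (exp (c powr q)) + 2 *
      (\<integral>\<^sup>+\<omega>. ennreal (exp (c powr q * \<bar>X \<omega>\<bar> powr q)) * indicator ?Pos \<omega> \<partial>M) < \<infinity>"
    by (simp add: ennreal_mult_less_top)
  \<comment> \<open>Taking \<open>s\<close> to be \<open>c powr q\<close> lets the scale
    \<open>c\<close> of \<open>B\<close> serve for \<open>A\<close> as well.\<close>
  with mixed_poisson_exp_moment_le[OF assms(1,2) ex q, of "c powr q"]
  have "(\<integral>\<^sup>+\<omega>. ennreal (exp (c powr q * \<bar>X \<omega>\<bar> powr q)) * indicator ?Neg \<omega> \<partial>M) < \<infinity>"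
    by (auto intro: le_less_trans)
  then have "integrable N\<^sub>A (\<lambda>\<omega>. exp (c powr q * \<bar>A \<omega>\<bar> powr q))"
    using transfer_A[OF neg, of "\<lambda>x. exp (c powr q * \<bar>x\<bar> powr q)"] by simp
  with c(1) show "subweibull q N\<^sub>A A"
    by (auto simp: subweibull_def)
qed

end
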